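(* Let $\chi\in\mathbb{R}$ with $\chi\neq\frac12$ and let $\gamma>0$. Then the dimer system $$\begin{cases} i \dot{q}_0 = q_1 - i\gamma q_0 + \left[(1-\chi) |q_0|^2 + \chi |q_1|^2\right] q_0, \\ i \dot{q}_1 = q_0 + i \gamma q_1 + \left[\chi |q_0|^2 + (1 - \chi) |q_1|^2\right] q_1 \end{cases}$$ has a solution $(q_0(t),q_1(t))$ that is unbounded as $t\to\infty$.
   Context: $q_0,q_1$ are complex-valued functions of the real variable $t$ and the overdot denotes $d/dt$. Solutions exist globally in time. *)

theory Defs
  imports "HOL-Analysis.Analysis"
begin

(* Solutions are global: the equations are required at every real time t. *)
definition dimer_solution ::
  "real \<Rightarrow> real \<Rightarrow> (real \<Rightarrow> complex) \<Rightarrow> (real \<Rightarrow> complex) \<Rightarrow> bool" where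
  "dimer_solution chi \<gamma> q0 q1 \<longleftrightarrow>
     (\<forall>t. q0 differentiable (at t) \<and> q1 differentiable (at t) \<and>
       \<i> * vector_derivative q0 (at t) =
         q1 t - \<i> * of_real \<gamma> * q0 t
           + of_real ((1 - chi) * (cmod (q0 t))\<^sup>2 + chi * (cmod (q1 t))\<^sup>2) * q0 t \<and>
       \<i> * vector_derivative q1 (at t) =
         q0 t + \<i> * of_real \<gamma> * q1 t
           + of_real (chi * (cmod (q0 t))\<^sup>2 + (1 - chi) * (cmod (q1 t))\<^sup>2) * q1 t)"

end

(* The product cnj q0 * q1 moves on a circle centred at 1 / (1 - 2 chi).  If it starts at
   the centre it stays there, and then |q0|^2 decays and |q1|^2 grows exactly at rate
   2 gamma.  This leaves only a common phase, which is found by integration, so the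
   unbounded solution is explicit. *)
theory Submission
  imports Defs
begin

text \<open>Factoring out \<open>cis\<close> lets each equation below split into a real and an
  imaginary identity between amplitudes. The amplitude \<open>r\<close> may be negative, as it is
  for \<open>q1\<close> when \<open>chi\<close> exceeds 1/2.\<close>

lemma has_vector_derivative_polar:
  assumes "(r has_real_derivative r') (at t)" and "(\<phi> has_real_derivative \<omega>) (at t)"
  shows "((\<lambda>t. of_real (r t) * cis (\<phi> t)) has_vector_derivative
           (of_real r' + \<i> * of_real (r t * \<omega>)) * cis (\<phi> t)) (at t)"
proof -
  have "((\<lambda>t. of_real (r t) :: complex) has_vector_derivative of_real r') (at t)"
    using assms(1) by (rule has_vector_derivative_of_real)
  moreover have "((\<lambda>t. cis (\<phi> t)) has_vector_derivative \<omega> *\<^sub>R (\<i> * cis (\<phi> t))) (at t)"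
    using assms(2) unfolding has_vector_derivative_complex_iff
    by (auto intro!: derivative_eq_intros)
  ultimately show ?thesis
    using has_vector_derivative_mult
    by (fastforce simp: scaleR_conv_of_real algebra_simps)
qed

theorem theorem3p1:
  fixes chi \<gamma> :: real
  assumes "chi \<noteq> 1 / 2" and "\<gamma> > 0"
  shows "\<exists>q0 q1. dimer_solution chi \<gamma> q0 q1 \<and> \<not> Bfun (\<lambda>t. (q0 t, q1 t)) at_top"
proof -
  define b where "b = 1 / (1 - 2 * chi)"
  have b: "b \<noteq> 0" and bchi: "b = (1 - 2 * chi) * b\<^sup>2"
    using assms(1) by (auto simp: b_def power2_eq_square)
  \<comment> \<open>An antiderivative of the phase speed \<open>\<omega>\<close> defined
    next.\<close>
  define \<phi> where "\<phi> t =
    ((1 - chi) * exp (- (2 * \<gamma> * t)) - (1 - chi) * b\<^sup>2 * exp (2 * \<gamma> * t)) / (2 * \<gamma>)" for t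
  \<comment> \<open>Dividing the first equation by \<open>q0\<close> turns the coupling into b * exp
    (2\<gamma>t), which is (1 - 2 chi) * |q1|^2 by the choice of \<open>b\<close>; this raises the
    coefficient chi of |q1|^2 to 1 - chi. In the second equation the coupling does the same to
    |q0|^2, so both components call for the same phase speed.\<close>
  define \<omega> where "\<omega> t =
    - ((1 - chi) * (exp (- (\<gamma> * t)))\<^sup>2 + (1 - chi) * b\<^sup>2 * (exp (\<gamma> * t))\<^sup>2)" for t
  define q0 where "q0 t = of_real (exp (- (\<gamma> * t))) * cis (\<phi> t)" for t
  define q1 where "q1 t = of_real (b * exp (\<gamma> * t)) * cis (\<phi> t)" for t
  have \<phi>': "(\<phi> has_real_derivative \<omega> t) (at t)" for t
    unfolding \<phi>_def \<omega>_def exp_double[symmetric] using assms(2)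
    by (auto intro!: derivative_eq_intros simp: field_simps simp flip: exp_double)
  have q0': "(q0 has_vector_derivative
      (of_real (- \<gamma> * exp (- (\<gamma> * t))) + \<i> * of_real (exp (- (\<gamma> * t)) * \<omega> t)) * cis (\<phi> t)) (at t)" for t
    unfolding q0_def
    by (rule has_vector_derivative_polar[OF _ \<phi>']) (auto intro!: derivative_eq_intros)
  have q1': "(q1 has_vector_derivative
      (of_real (\<gamma> * (b * exp (\<gamma> * t))) + \<i> * of_real (b * exp (\<gamma> * t) * \<omega> t)) * cis (\<phi> t)) (at t)" for t
    unfolding q1_def
    by (rule has_vector_derivative_polar[OF _ \<phi>']) (auto intro!: derivative_eq_intros)
  have norms: "cmod (q0 t) = exp (- (\<gamma> * t))" "cmod (q1 t) = \<bar>b\<bar> * exp (\<gamma> * t)" for t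
    by (simp_all add: q0_def q1_def norm_mult)
  have "dimer_solution chi \<gamma> q0 q1"
    unfolding dimer_solution_def
  proof (intro allI conjI)
    fix t
    show "q0 differentiable (at t)" "q1 differentiable (at t)"
      using q0' q1' by (auto intro: differentiableI_vector)
    define x where "x = exp (- (\<gamma> * t))"
    define y where "y = exp (\<gamma> * t)"
    \<comment> \<open>The constancy of cnj q0 * q1 in terms of amplitudes. The identities
      \<open>re0\<close> and \<open>re1\<close> are polynomial consequences of this and the defining
      relation of \<open>b\<close>.\<close>
    have xy: "x * y = 1"
      by (simp add: x_def y_def flip: exp_add)
    have polar: "q0 t = of_real x * cis (\<phi> t)" "q1 t = of_real (b * y) * cis (\<phi> t)"
      and sq: "(cmod (q0 t))\<^sup>2 = x\<^sup>2" "(cmod (q1 t))\<^sup>2 = b\<^sup>2 * y\<^sup>2"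
      and \<omega>: "\<omega> t = - ((1 - chi) * x\<^sup>2 + (1 - chi) * b\<^sup>2 * y\<^sup>2)"
      unfolding norms by (simp_all add: q0_def q1_def x_def y_def \<omega>_def power_mult_distrib)
    \<comment> \<open>After \<open>cis (\<phi> t)\<close> is cancelled, \<open>re0\<close> and
      \<open>re1\<close> are the real parts of the two equations. The imaginary parts, loss and
      gain, are matched by the exponential amplitudes.\<close>
    have re0: "- (x * \<omega> t) = b * y + ((1 - chi) * x\<^sup>2 + chi * (b\<^sup>2 * y\<^sup>2)) * x"
      unfolding \<omega> using xy bchi by algebra
    have re1: "- (b * y * \<omega> t) = x + (chi * x\<^sup>2 + (1 - chi) * (b\<^sup>2 * y\<^sup>2)) * (b * y)"
    proof -
      have "b * (1 - 2 * chi) = 1"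
        using assms(1) by (simp add: b_def)
      then show ?thesis
        unfolding \<omega> using xy by algebra
    qed
    have "\<i> * vector_derivative q0 (at t) =
        (of_real (- (x * \<omega> t)) - \<i> * of_real \<gamma> * of_real x) * cis (\<phi> t)"
      by (simp add: vector_derivative_at[OF q0'] x_def algebra_simps)
    also have "\<dots> = q1 t - \<i> * of_real \<gamma> * q0 t
        + of_real ((1 - chi) * (cmod (q0 t))\<^sup>2 + chi * (cmod (q1 t))\<^sup>2) * q0 t"
      \<comment> \<open>The moduli are replaced first, while \<open>q0 t\<close> and
        \<open>q1 t\<close> still stand inside \<open>cmod\<close>; only then is the polar form
        inserted.\<close>
      unfolding re0 sq unfolding polar by (simp add: algebra_simps)
    finally show "\<i> * vector_derivative q0 (at t) = \<dots>" .
    have "\<i> * vector_derivative q1 (at t) =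
        (of_real (- (b * y * \<omega> t)) + \<i> * of_real \<gamma> * of_real (b * y)) * cis (\<phi> t)"
      by (simp add: vector_derivative_at[OF q1'] y_def algebra_simps)
    also have "\<dots> = q0 t + \<i> * of_real \<gamma> * q1 t
        + of_real (chi * (cmod (q0 t))\<^sup>2 + (1 - chi) * (cmod (q1 t))\<^sup>2) * q1 t"
      unfolding re1 sq unfolding polar by (simp add: algebra_simps)
    finally show "\<i> * vector_derivative q1 (at t) = \<dots>" .
  qed
  moreover have "\<not> Bfun (\<lambda>t. (q0 t, q1 t)) at_top"
  proof
    assume "Bfun (\<lambda>t. (q0 t, q1 t)) at_top"
    then obtain K where "\<forall>\<^sub>F t in at_top. norm (q0 t, q1 t) \<le> K"
      by (auto elim: BfunE)
    \<comment> \<open>A bound on the pair bounds \<open>q1\<close>, the growing component; since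
      \<open>b\<close> is nonzero, its modulus exceeds every bound.\<close>
    then have "\<forall>\<^sub>F t in at_top. \<bar>b\<bar> * exp (\<gamma> * t) \<le> K"
      by eventually_elim (metis norms(2) norm_snd_le order_trans snd_conv)
    moreover have "filterlim (\<lambda>t. \<bar>b\<bar> * exp (\<gamma> * t)) at_top at_top"
      using b assms(2)
      by (intro filterlim_tendsto_pos_mult_at_top[OF tendsto_const]
          filterlim_compose[OF exp_at_top] filterlim_ident) auto
    then have "\<forall>\<^sub>F t in at_top. \<bar>b\<bar> * exp (\<gamma> * t) > K"
      by (simp add: filterlim_at_top_dense)
    ultimately have "\<forall>\<^sub>F _ in (at_top :: real filter). False"
      by eventually_elim simp
    then show False
      by simp
  qed
  ultimately show ?thesis
    by blast
qed

end
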